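(* Let $m$ be an integer, $p$ an odd integer and $n$ a positive integer. Then \[ \sum_{j=1}^n\binom{n}{j}\Big\lfloor\frac{j}{2}\Big\rfloor F_{2pj+m}= \begin{cases} \frac{n\sqrt{5^{n-1}}}{2}F_p^{n-1}F_{p(n+1)+m}-\frac{\sqrt{5^{n-1}}}{4}F_p^nL_{pn+m}-\frac14L_p^nF_{pn+m}, & n\text{ odd};\\[4pt] \frac{n\sqrt{5^{n-2}}}{2}F_p^{n-1}L_{p(n+1)+m}-\frac{\sqrt{5^{n}}}{4}F_p^nF_{pn+m}+\frac14L_p^nF_{pn+m}, & n\text{ even}, \end{cases} \] and \[ \sum_{j=1}^n\binom{n}{j}\Big\lfloor\frac{j}{2}\Big\rfloor L_{2pj+m}= \begin{cases} \frac{n\sqrt{5^{n-1}}}{2}F_p^{n-1}L_{p(n+1)+m}-\frac{\sqrt{5^{n+1}}}{4}F_p^nF_{pn+m}-\frac14L_p^nL_{pn+m}, & n\text{ odd};\\[4pt] \frac{n\sqrt{5^{n}}}{2}F_p^{n-1}F_{p(n+1)+m}-\frac{\sqrt{5^{n}}}{4}F_p^nL_{pn+m}+\frac14L_p^nL_{pn+m}, & n\text{ even}. \end{cases} \]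
   Context: $F_n$ and $L_n$ are the Fibonacci and Lucas numbers, defined for all integers $n$ by $F_n=(\alpha^n-\beta^n)/\sqrt5$, $L_n=\alpha^n+\beta^n$ with $\alpha=(1+\sqrt5)/2$, $\beta=(1-\sqrt5)/2$. $\lfloor x\rfloor$ is the floor function. *)

theory Defs
  imports Complex_Main
begin

definition golden :: real where
  "golden = (1 + sqrt 5) / 2"

definition golden_conj :: real where
  "golden_conj = (1 - sqrt 5) / 2"

text \<open>
  Fibonacci and Lucas numbers at arbitrary integer index, given by the Binet formulas and hence
  real-valued; the exponents are integers, so \<open>powi\<close> is used.
\<close>

definition Fibonacci :: "int \<Rightarrow> real" where
  "Fibonacci n = (golden powi n - golden_conj powi n) / sqrt 5"

definition Lucas :: "int \<Rightarrow> real" where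
  "Lucas n = golden powi n + golden_conj powi n"

end

theory Submission
  imports Defs
begin

text \<open>
  Since \<open>\<lfloor>j/2\<rfloor> = j/2 - (1 - (-1)^j)/4\<close>, the binomial theorem evaluates
  \<open>\<Sum>j. (n choose j) \<lfloor>j/2\<rfloor> x^j\<close> as \<open>(n/2) x (1+x)^(n-1) - (1+x)^n/4 + (1-x)^n/4\<close>.
  Take \<open>x = \<alpha>^(2p)\<close> and \<open>x = \<beta>^(2p)\<close>. As \<open>p\<close> is odd, \<open>\<alpha>^p \<beta>^p = -1\<close>, so \<open>1 + x\<close> factors as
  \<open>\<surd>5 F_p \<alpha>^p\<close> and \<open>-\<surd>5 F_p \<beta>^p\<close>, while \<open>1 - x\<close> factors as \<open>-L_p \<alpha>^p\<close> and \<open>-L_p \<beta>^p\<close>.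
  Combining the two evaluations by the Binet formulas gives both identities; the sign \<open>(-1)^n\<close> coming
  from \<open>(-\<surd>5)^n\<close> decides whether Fibonacci or Lucas numbers appear.
\<close>

lemma of_int_floor_half: "of_int \<lfloor>real j / 2\<rfloor> = real j / 2 - (1 - (-1) ^ j) / 4"
proof (cases "even j")
  case True
  then show ?thesis by (auto elim!: evenE)
next
  case False
  then obtain k where j: "j = 2 * k + 1" by (auto elim: oddE)
  have "\<lfloor>real j / 2\<rfloor> = int k"
    unfolding j by (rule floor_unique) (auto simp: field_simps)
  then show ?thesis unfolding j by (simp add: field_simps)
qed

text \<open>This is \<open>x\<close> times the derivative of the binomial theorem, obtained by
  absorption: \<open>Suc j\<close> times \<open>Suc k choose Suc j\<close> is \<open>Suc k\<close>
  times \<open>k choose j\<close>.\<close>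

lemma sum_times_binomial_power:
  fixes x :: "'a :: comm_ring_1"
  shows "(\<Sum>j\<le>n. of_nat (n choose j) * of_nat j * x ^ j) = of_nat n * x * (1 + x) ^ (n - 1)"
proof (cases n)
  case 0
  then show ?thesis by simp
next
  case (Suc k)
  have "(\<Sum>j\<le>Suc k. of_nat (Suc k choose j) * of_nat j * x ^ j)
      = (\<Sum>j\<le>k. of_nat (Suc k choose Suc j) * of_nat (Suc j) * x ^ Suc j)"
    by (subst sum.atMost_Suc_shift) simp
  also have "\<dots> = (\<Sum>j\<le>k. of_nat (Suc k) * x * (of_nat (k choose j) * x ^ j * 1 ^ (k - j)))"
  proof (rule sum.cong)
    fix j
    have "of_nat (Suc k choose Suc j) * of_nat (Suc j) = (of_nat (Suc k) * of_nat (k choose j) :: 'a)"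
      using Suc_times_binomial[of j k] by (metis mult.commute of_nat_mult)
    then show "of_nat (Suc k choose Suc j) * of_nat (Suc j) * x ^ Suc j
        = of_nat (Suc k) * x * (of_nat (k choose j) * x ^ j * 1 ^ (k - j))"
      by (simp only: power_one power_Suc mult_1_left mult_1_right ac_simps)
  qed simp
  also have "\<dots> = of_nat (Suc k) * x * (x + 1) ^ k"
    by (simp only: binomial_ring sum_distrib_left)
  finally show ?thesis using Suc by (simp add: add.commute)
qed

lemma sum_binomial_floor_half_power:
  fixes x :: real
  shows "(\<Sum>j = 1..n. real (n choose j) * of_int \<lfloor>real j / 2\<rfloor> * x ^ j)
    = real n / 2 * x * (1 + x) ^ (n - 1) - (1 + x) ^ n / 4 + (1 - x) ^ n / 4"
proof -
  have "(\<Sum>j = 1..n. real (n choose j) * of_int \<lfloor>real j / 2\<rfloor> * x ^ j)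
      = (\<Sum>j\<le>n. real (n choose j) * of_int \<lfloor>real j / 2\<rfloor> * x ^ j)"
    by (rule sum.mono_neutral_left) (auto simp: not_le)
  \<comment> \<open>The sign \<open>(-1) ^ j\<close> from the floor is absorbed into
    \<open>(- x) ^ j\<close>; the factors \<open>1 ^ (n - j)\<close> give the last two sums the
    shape of \<open>binomial_ring\<close>.\<close>
  also have "\<dots> = (\<Sum>j\<le>n. 1 / 2 * (real (n choose j) * real j * x ^ j)
      - 1 / 4 * (real (n choose j) * x ^ j * 1 ^ (n - j))
      + 1 / 4 * (real (n choose j) * (- x) ^ j * 1 ^ (n - j)))"
    by (rule sum.cong)
      (simp_all add: of_int_floor_half power_minus[of x] field_simps)
  also have "\<dots> = 1 / 2 * (\<Sum>j\<le>n. real (n choose j) * real j * x ^ j)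
      - 1 / 4 * (x + 1) ^ n + 1 / 4 * (- x + 1) ^ n"
    unfolding sum.distrib sum_subtractf sum_distrib_left[symmetric] binomial_ring ..
  finally show ?thesis
    unfolding sum_times_binomial_power by (simp add: add.commute)
qed

lemma sum_binomial_floor_half_power_int:
  fixes g d l :: real and p m :: int
  assumes "g \<noteq> 0" and "n > 0"
    and plus: "1 + (g powi p)\<^sup>2 = d * g powi p"
    and minus: "1 - (g powi p)\<^sup>2 = l * g powi p"
  shows "(\<Sum>j = 1..n. real (n choose j) * of_int \<lfloor>real j / 2\<rfloor> * g powi (2 * p * int j + m))
    = real n / 2 * d ^ (n - 1) * g powi (p * (int n + 1) + m)
      - d ^ n / 4 * g powi (p * int n + m) + l ^ n / 4 * g powi (p * int n + m)"
proof -
  define a where "a = g powi p"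
  have split: "g powi (p * int k + m) = a ^ k * g powi m" for k
    using \<open>g \<noteq> 0\<close> by (simp add: a_def power_int_add power_int_mult)
  have "g powi (2 * p * int j + m) = (a\<^sup>2) ^ j * g powi m" for j
    unfolding power_mult[symmetric] using split[of "2 * j"] by (simp add: ac_simps)
  then have "(\<Sum>j = 1..n. real (n choose j) * of_int \<lfloor>real j / 2\<rfloor> * g powi (2 * p * int j + m))
      = (\<Sum>j = 1..n. real (n choose j) * of_int \<lfloor>real j / 2\<rfloor> * (a\<^sup>2) ^ j) * g powi m"
    by (simp add: sum_distrib_right mult.assoc)
  also have "\<dots> = (real n / 2 * a\<^sup>2 * (d * a) ^ (n - 1) - (d * a) ^ n / 4 + (l * a) ^ n / 4) * g powi m"
    unfolding sum_binomial_floor_half_power using plus minus by (simp add: a_def)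
  \<comment> \<open>Two factors \<open>a\<close> from \<open>x\<close> join the \<open>n - 1\<close>
    from \<open>1 + x\<close>; the total \<open>n + 1\<close> produces the index
    \<open>p * (int n + 1) + m\<close>.\<close>
  also have "a\<^sup>2 * (d * a) ^ (n - 1) = d ^ (n - 1) * a ^ Suc n"
    using \<open>n > 0\<close> by (cases n) (simp_all add: power_mult_distrib power2_eq_square)
  then have "real n / 2 * a\<^sup>2 * (d * a) ^ (n - 1) = real n / 2 * (d ^ (n - 1) * a ^ Suc n)"
    by (simp only: mult.assoc)
  finally show ?thesis
    using split[of n] split[of "Suc n"]
    by (simp add: power_mult_distrib algebra_simps)
qed

lemma golden_mult_golden_conj: "golden * golden_conj = -1"
  by (simp add: golden_def golden_conj_def field_simps)

theorem theorem16:
  fixes m p :: int and n :: nat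
  assumes "odd p" and "n > 0"
  shows
    "(\<Sum>j = 1..n. real (n choose j) * of_int \<lfloor>real j / 2\<rfloor> * Fibonacci (2 * p * int j + m)) =
      (if odd n then
         real n * sqrt (5 ^ (n - 1)) / 2 * Fibonacci p ^ (n - 1) * Fibonacci (p * (int n + 1) + m)
         - sqrt (5 ^ (n - 1)) / 4 * Fibonacci p ^ n * Lucas (p * int n + m)
         - 1 / 4 * Lucas p ^ n * Fibonacci (p * int n + m)
       else
         real n * sqrt (5 ^ (n - 2)) / 2 * Fibonacci p ^ (n - 1) * Lucas (p * (int n + 1) + m)
         - sqrt (5 ^ n) / 4 * Fibonacci p ^ n * Fibonacci (p * int n + m)
         + 1 / 4 * Lucas p ^ n * Fibonacci (p * int n + m))
     \<and>
     (\<Sum>j = 1..n. real (n choose j) * of_int \<lfloor>real j / 2\<rfloor> * Lucas (2 * p * int j + m)) =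
      (if odd n then
         real n * sqrt (5 ^ (n - 1)) / 2 * Fibonacci p ^ (n - 1) * Lucas (p * (int n + 1) + m)
         - sqrt (5 ^ (n + 1)) / 4 * Fibonacci p ^ n * Fibonacci (p * int n + m)
         - 1 / 4 * Lucas p ^ n * Lucas (p * int n + m)
       else
         real n * sqrt (5 ^ n) / 2 * Fibonacci p ^ (n - 1) * Fibonacci (p * (int n + 1) + m)
         - sqrt (5 ^ n) / 4 * Fibonacci p ^ n * Lucas (p * int n + m)
         + 1 / 4 * Lucas p ^ n * Lucas (p * int n + m))"
proof -
  define s where "s = sqrt 5"
  define a b where "a = golden powi p" and "b = golden_conj powi p"
  define F L where "F = Fibonacci p" and "L = Lucas p"
  have s: "s \<noteq> 0" "s * s = 5" by (simp_all add: s_def)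
  then have ss: "s * (s * t) = 5 * t" for t
    by (simp flip: mult.assoc)
  have nz: "golden \<noteq> 0" "golden_conj \<noteq> 0"
    using golden_mult_golden_conj by auto
  \<comment> \<open>Oddness of \<open>p\<close> enters here, through
    \<open>(-1) powi p = -1\<close>.\<close>
  have ab: "a * b = -1"
    using \<open>odd p\<close> by (simp add: a_def b_def golden_mult_golden_conj flip: power_int_mult_distrib)
  have F: "s * F = a - b" and L: "L = a + b"
    using s by (simp_all add: F_def L_def Fibonacci_def Lucas_def a_def b_def s_def)
  note S = sum_binomial_floor_half_power_int[OF _ \<open>n > 0\<close>, where p = p and m = m]
  have A: "(\<Sum>j = 1..n. real (n choose j) * of_int \<lfloor>real j / 2\<rfloor> * golden powi (2 * p * int j + m))
    = real n / 2 * (s * F) ^ (n - 1) * golden powi (p * (int n + 1) + m)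
      - (s * F) ^ n / 4 * golden powi (p * int n + m) + (- L) ^ n / 4 * golden powi (p * int n + m)"
    (is "?A = _")
    \<comment> \<open>Since \<open>a * b = -1\<close>, \<open>(a - b) * a = 1 + a * a\<close> and
      \<open>- (a + b) * a = 1 - a * a\<close>. For \<open>b\<close> the first cofactor changes sign
      and the second does not.\<close>
    by (rule S[OF nz(1)]; fold a_def; unfold F L; use ab in \<open>simp add: power2_eq_square algebra_simps\<close>)
  have B: "(\<Sum>j = 1..n. real (n choose j) * of_int \<lfloor>real j / 2\<rfloor> * golden_conj powi (2 * p * int j + m))
    = real n / 2 * (- (s * F)) ^ (n - 1) * golden_conj powi (p * (int n + 1) + m)
      - (- (s * F)) ^ n / 4 * golden_conj powi (p * int n + m)
      + (- L) ^ n / 4 * golden_conj powi (p * int n + m)"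
    (is "?B = _")
    by (rule S[OF nz(2)]; fold b_def; unfold F L; use ab in \<open>simp add: power2_eq_square algebra_simps\<close>)
  have fib: "(\<Sum>j = 1..n. real (n choose j) * of_int \<lfloor>real j / 2\<rfloor> * Fibonacci (2 * p * int j + m))
      = (?A - ?B) / s"
    by (simp add: Fibonacci_def s_def right_diff_distrib diff_divide_distrib
        sum_subtractf sum_divide_distrib)
  have luc: "(\<Sum>j = 1..n. real (n choose j) * of_int \<lfloor>real j / 2\<rfloor> * Lucas (2 * p * int j + m))
      = ?A + ?B"
    by (simp add: Lucas_def distrib_left sum.distrib)
  note unf = Fibonacci_def[of "p * (int n + 1) + m"] Fibonacci_def[of "p * int n + m"]
    Lucas_def[of "p * (int n + 1) + m"] Lucas_def[of "p * int n + m"]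
    real_sqrt_power
  \<comment> \<open>Opaque names keep the simplifier from rearranging the exponents.\<close>
  obtain x y z w where gen:
    "golden powi (p * (int n + 1) + m) = x" "golden_conj powi (p * (int n + 1) + m) = y"
    "golden powi (p * int n + m) = z" "golden_conj powi (p * int n + m) = w"
    by blast
  note goal_simps = fib luc A B unf F_def[symmetric] L_def[symmetric] s_def[symmetric] gen
  have Fn: "F ^ n = F * F ^ (n - 1)"
    using \<open>n > 0\<close> by (simp add: power_eq_if)
  show ?thesis
  proof (cases "odd n")
    case True
    \<comment> \<open>All powers of \<open>s\<close> are expressed by the lowest one in the claim,
      so that both sides compare as polynomials once \<open>s * s = 5\<close> is applied.\<close>
    then have "s ^ n = s * s ^ (n - 1)" "s ^ (n + 1) = s * s * s ^ (n - 1)"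
      using \<open>n > 0\<close> by (simp_all add: power_eq_if)
    then show ?thesis
      unfolding goal_simps
      using True s by (simp add: power_mult_distrib Fn ss field_simps)
  next
    case False
    then obtain k where "n = 2 * k" by (auto elim: evenE)
    \<comment> \<open>A positive even \<open>n\<close> is at least 2, so \<open>n - 2\<close> is not
      truncated and \<open>s ^ (n - 2)\<close> can be the base power.\<close>
    with \<open>n > 0\<close> have n: "n = Suc (Suc (n - 2))" by simp
    have "s ^ (n - 1) = s * s ^ (n - 2)" "s ^ n = s * s * s ^ (n - 2)"
      by (subst n, simp)+
    then show ?thesis
      unfolding goal_simps
      using False s \<open>n > 0\<close> by (simp add: power_mult_distrib Fn ss field_simps)
  qed
qed

end
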